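(* Let $N\ge 2$, $\omega\in\mathbb{R}$, $\kappa>0$, $\tau>0$, and let $x_j(t)=\Omega t$ ($j=1,\dots,N$), with $\Omega\in\mathbb{R}$, be a synchronous solution of the unidirectional ring of delay-coupled phase oscillators $$\dot{x}_{j}(t)=\omega+\kappa\sin\left(x_{j+1}(t-\tau)-x_{j}(t)\right),\qquad j=1,\dots,N,\quad x_{N+1}:=x_1 ,$$ that is, $\Omega=\omega-\kappa\sin(\Omega\tau)$. Then this solution is linearly stable if and only if $\cos(\Omega\tau)>0$. Furthermore, if $\cos(\Omega\tau)<0$, then every characteristic exponent $\mu\in\mathbb{C}$ of this solution satisfies $$\Re(\mu)\le -2\kappa\cos(\Omega\tau).$$
   Context: The variables $x_j$ are phases, taken in $\mathbb{R}/2\pi\mathbb{Z}$, and indices are taken modulo $N$. Linearizing the system along the synchronous solution $x_j(t)=\Omega t$ gives $\dot\xi(t)=-K\xi(t)+KG\xi(t-\tau)$, where $K=\kappa\cos(\Omega\tau)$ and $G=(g_{ij})$ is the $N\times N$ matrix with $g_{ij}=1$ if $j\equiv i+1 \pmod N$ and $g_{ij}=0$ otherwise. The characteristic exponents of the solution are the zeros $\mu\in\mathbb{C}$ of $$F(\mu)=\det\left(-\mu\,\mathrm{Id}-K\,\mathrm{Id}+Ke^{-\mu\tau}G\right).$$ Equivalently (up to a sign that does not affect the zeros), they are the solutions of $\mu+K-Ke^{-\mu\tau}e^{2\pi i n/N}=0$ for $n=0,\dots,N-1$. The value $\mu=0$ is always a characteristic exponent (the trivial one, corresponding to perturbations along the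 periodic motion). The solution is called linearly stable if the trivial exponent $\mu=0$ is a simple zero of $F$ and all other characteristic exponents have negative real part. *)

theory Defs
  imports
    "HOL-Complex_Analysis.Complex_Analysis"
    "Jordan_Normal_Form.Determinant"
begin

text \<open>
  Oscillators are indexed by \<open>0, \<dots>, N - 1\<close> instead of \<open>1, \<dots>, N\<close>, so that the neighbour of \<open>j\<close> is
  \<open>(j + 1) mod N\<close>. Phases are represented by real-valued lifts; this is harmless because they
  enter the system only through the sine of a phase difference.
\<close>

definition ring_rhs ::
    "nat \<Rightarrow> real \<Rightarrow> real \<Rightarrow> nat \<Rightarrow> (nat \<Rightarrow> real) \<Rightarrow> (nat \<Rightarrow> real) \<Rightarrow> real" where
  "ring_rhs N \<omega> \<kappa> j u v = \<omega> + \<kappa> * sin (v ((j + 1) mod N) - u j)"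

definition ring_solution ::
    "nat \<Rightarrow> real \<Rightarrow> real \<Rightarrow> real \<Rightarrow> (nat \<Rightarrow> real \<Rightarrow> real) \<Rightarrow> bool" where
  "ring_solution N \<omega> \<kappa> \<tau> x \<longleftrightarrow>
    (\<forall>j<N. \<forall>t. (x j has_real_derivative
       ring_rhs N \<omega> \<kappa> j (\<lambda>i. x i t) (\<lambda>i. x i (t - \<tau>))) (at t))"

definition sync :: "real \<Rightarrow> nat \<Rightarrow> real \<Rightarrow> real" where
  "sync \<Omega> j t = \<Omega> * t"

lemma ring_solution_sync_iff:
  assumes "N > 0"
  shows "ring_solution N \<omega> \<kappa> \<tau> (sync \<Omega>) \<longleftrightarrow> \<Omega> = \<omega> - \<kappa> * sin (\<Omega> * \<tau>)"
proof -
  have rhs: "ring_rhs N \<omega> \<kappa> j (\<lambda>i. sync \<Omega> i t) (\<lambda>i. sync \<Omega> i (t - \<tau>))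
      = \<omega> - \<kappa> * sin (\<Omega> * \<tau>)" for j t
  proof -
    have "\<Omega> * (t - \<tau>) - \<Omega> * t = - (\<Omega> * \<tau>)" by (simp add: algebra_simps)
    then show ?thesis by (simp add: ring_rhs_def sync_def)
  qed
  have der: "(sync \<Omega> j has_real_derivative \<Omega>) (at t)" for j t
    unfolding sync_def [abs_def] by (auto intro!: derivative_eq_intros)
  have "\<Omega> = \<omega> - \<kappa> * sin (\<Omega> * \<tau>)" if "ring_solution N \<omega> \<kappa> \<tau> (sync \<Omega>)"
  proof -
    have "(sync \<Omega> 0 has_real_derivative \<omega> - \<kappa> * sin (\<Omega> * \<tau>)) (at 0)"
      using that assms by (simp only: ring_solution_def rhs)
    with der [of 0 0] show ?thesis by (rule DERIV_unique)
  qed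
  moreover have "ring_solution N \<omega> \<kappa> \<tau> (sync \<Omega>)" if eq: "\<Omega> = \<omega> - \<kappa> * sin (\<Omega> * \<tau>)"
    unfolding ring_solution_def rhs eq [symmetric] using der by simp
  ultimately show ?thesis by (rule iffI)
qed

definition ring_matrix :: "nat \<Rightarrow> 'a :: zero_neq_one mat" where
  "ring_matrix N = mat N N (\<lambda>(i, j). if j = (i + 1) mod N then 1 else 0)"

definition sync_gain :: "real \<Rightarrow> real \<Rightarrow> real \<Rightarrow> real" where
  "sync_gain \<kappa> \<tau> \<Omega> = \<kappa> * cos (\<Omega> * \<tau>)"

text \<open>
  The linearization along the synchronous solution is
  \<open>\<xi>'(t) = - K \<xi>(t) + K G \<xi>(t - \<tau>)\<close> with \<open>K = sync_gain \<kappa> \<tau> \<Omega>\<close> and \<open>G = ring_matrix N\<close>: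
\<close>

lemma ring_rhs_linearization:
  assumes "j < N"
  shows "((\<lambda>\<epsilon>. ring_rhs N \<omega> \<kappa> j (\<lambda>i. sync \<Omega> i t + \<epsilon> * \<xi> i t)
                 (\<lambda>i. sync \<Omega> i (t - \<tau>) + \<epsilon> * \<xi> i (t - \<tau>)))
          has_real_derivative
            (- sync_gain \<kappa> \<tau> \<Omega> * \<xi> j t
             + sync_gain \<kappa> \<tau> \<Omega> * (\<Sum>i<N. ring_matrix N $$ (j, i) * \<xi> i (t - \<tau>)))) (at 0)"
proof -
  have "(\<Sum>i<N. ring_matrix N $$ (j, i) * \<xi> i (t - \<tau>))
      = (\<Sum>i<N. if i = (j + 1) mod N then \<xi> i (t - \<tau>) else 0)"
    using assms by (intro sum.cong) (auto simp: ring_matrix_def)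
  also have "\<dots> = \<xi> ((j + 1) mod N) (t - \<tau>)"
    using assms by (simp add: sum.delta)
  finally have sum: "(\<Sum>i<N. ring_matrix N $$ (j, i) * \<xi> i (t - \<tau>)) = \<xi> ((j + 1) mod N) (t - \<tau>)" .
  let ?v = "\<xi> ((j + 1) mod N) (t - \<tau>)" and ?u = "\<xi> j t"
  have "((\<lambda>\<epsilon>. \<omega> + \<kappa> * sin ((a + \<epsilon> * v) - (b + \<epsilon> * u))) has_real_derivative
      \<kappa> * (cos ((a + 0 * v) - (b + 0 * u)) * (v - u))) (at 0)" for a b u v :: real
    by (auto intro!: derivative_eq_intros)
  from this [of "\<Omega> * (t - \<tau>)" ?v "\<Omega> * t" ?u]
  have der: "((\<lambda>\<epsilon>. \<omega> + \<kappa> * sin ((\<Omega> * (t - \<tau>) + \<epsilon> * ?v) - (\<Omega> * t + \<epsilon> * ?u))) has_real_derivative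
      \<kappa> * (cos (\<Omega> * (t - \<tau>) - \<Omega> * t) * (?v - ?u))) (at 0)" by simp
  have "\<Omega> * (t - \<tau>) - \<Omega> * t = - (\<Omega> * \<tau>)" by (simp add: algebra_simps)
  then have "cos (\<Omega> * (t - \<tau>) - \<Omega> * t) = cos (\<Omega> * \<tau>)" by (simp only: cos_minus)
  then have "\<kappa> * (cos (\<Omega> * (t - \<tau>) - \<Omega> * t) * (?v - ?u))
      = - sync_gain \<kappa> \<tau> \<Omega> * ?u + sync_gain \<kappa> \<tau> \<Omega> * ?v"
    by (simp only: sync_gain_def) (simp add: algebra_simps)
  with der show ?thesis
    unfolding sum ring_rhs_def sync_def by (simp only:)
qed

definition char_fun :: "nat \<Rightarrow> real \<Rightarrow> real \<Rightarrow> real \<Rightarrow> complex \<Rightarrow> complex" where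
  "char_fun N \<kappa> \<tau> \<Omega> \<mu> =
    (let K = complex_of_real (sync_gain \<kappa> \<tau> \<Omega>) in
     Determinant.det ((- \<mu>) \<cdot>\<^sub>m 1\<^sub>m N - K \<cdot>\<^sub>m 1\<^sub>m N
       + (K * exp (- \<mu> * complex_of_real \<tau>)) \<cdot>\<^sub>m ring_matrix N))"

definition char_exponent :: "nat \<Rightarrow> real \<Rightarrow> real \<Rightarrow> real \<Rightarrow> complex \<Rightarrow> bool" where
  "char_exponent N \<kappa> \<tau> \<Omega> \<mu> \<longleftrightarrow> char_fun N \<kappa> \<tau> \<Omega> \<mu> = 0"

definition linearly_stable :: "nat \<Rightarrow> real \<Rightarrow> real \<Rightarrow> real \<Rightarrow> bool" where
  "linearly_stable N \<kappa> \<tau> \<Omega> \<longleftrightarrow>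
    char_exponent N \<kappa> \<tau> \<Omega> 0 \<and> zorder (char_fun N \<kappa> \<tau> \<Omega>) 0 = 1 \<and>
    (\<forall>\<mu>. char_exponent N \<kappa> \<tau> \<Omega> \<mu> \<and> \<mu> \<noteq> 0 \<longrightarrow> Re \<mu> < 0)"

end

theory Submission
  imports Defs
begin

text \<open>
  Since \<open>G\<close> is a cyclic permutation matrix, \<open>det (a Id + b G) = a ^ N - (- b) ^ N\<close>, so \<open>\<mu>\<close> is a
  characteristic exponent iff \<open>(\<mu> + K) ^ N = (K exp (- \<mu> \<tau>)) ^ N\<close>; in particular
  \<open>cmod (\<mu> + K) = \<bar>K\<bar> exp (- \<tau> Re \<mu>)\<close>. Comparing moduli for \<open>Re \<mu> \<ge> 0\<close> shows stability for \<open>K > 0\<close>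
  and confines the exponents to \<open>Re \<mu> \<le> - 2 K\<close> for \<open>K < 0\<close>. If \<open>K = 0\<close>, then \<open>0\<close> is a zero of
  order \<open>N \<ge> 2\<close>. If \<open>K = - k < 0\<close>, then for an \<open>N\<close>-th root of unity \<open>c \<noteq> 1\<close> the map
  \<open>\<mu> \<mapsto> k - k c exp (- \<mu> \<tau>)\<close> sends the disc of radius \<open>k\<close> about \<open>k\<close> into itself, because
  that disc lies in the closed right half-plane. Its Brouwer fixed point is a characteristic
  exponent with nonnegative real part, and it is not \<open>0\<close>.
\<close>

lemma det_const_diag_upper:
  fixes A :: "'a :: comm_ring_1 mat"
  assumes "A \<in> carrier_mat n n" "upper_triangular A" "\<And>i. i < n \<Longrightarrow> A $$ (i, i) = a"
  shows "Determinant.det A = a ^ n"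
proof -
  have "diag_mat A = replicate n a"
    using assms(1,3) by (auto simp: diag_mat_def intro!: nth_equalityI)
  then show ?thesis
    by (simp add: det_upper_triangular [OF assms(2,1)] prod_list_replicate)
qed

lemma det_const_diag_lower:
  fixes A :: "'a :: comm_ring_1 mat"
  assumes "A \<in> carrier_mat n n" "\<And>i j. i < j \<Longrightarrow> j < n \<Longrightarrow> A $$ (i, j) = 0"
    "\<And>i. i < n \<Longrightarrow> A $$ (i, i) = a"
  shows "Determinant.det A = a ^ n"
proof -
  have "diag_mat A = replicate n a"
    using assms(1,3) by (auto simp: diag_mat_def intro!: nth_equalityI)
  then show ?thesis
    by (simp add: det_lower_triangular [OF assms(2,1)] prod_list_replicate)
qed

text \<open>Expand along column 0, where only rows 0 and \<open>N - 1\<close> have nonzero entries.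
  Deleting row 0 leaves an upper triangular minor with diagonal a; deleting row \<open>N - 1\<close>
  moves the entries b onto the diagonal and the entries a below it.\<close>

lemma det_ring_matrix:
  fixes a b :: "'a :: comm_ring_1"
  assumes "N \<ge> 2"
  shows "Determinant.det (a \<cdot>\<^sub>m 1\<^sub>m N + b \<cdot>\<^sub>m ring_matrix N) = a ^ N - (- b) ^ N"
proof -
  obtain m where m: "N = Suc m" "m > 0" using assms by (cases N) auto
  define A where "A = a \<cdot>\<^sub>m 1\<^sub>m N + b \<cdot>\<^sub>m ring_matrix N"
  have A: "A \<in> carrier_mat N N" by (simp add: A_def ring_matrix_def)
  \<comment> \<open>For N \<ge> 2 the positions i and \<open>Suc i mod N\<close> differ, so a and b
    never add up in one entry.\<close>
  have ind: "A $$ (i, j) = (if i = j then a else if j = Suc i mod N then b else 0)"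
    if "i < N" "j < N" for i j
    using that assms by (auto simp: A_def ring_matrix_def mod_Suc)
  have dims: "mat_delete A i j \<in> carrier_mat m m" for i j
    using A m by (auto simp: mat_delete_def)
  have del: "mat_delete A i 0 $$ (r, s) = A $$ (if r < i then r else Suc r, Suc s)"
    if "r < m" "s < m" for i r s
    using that A m by (auto simp: mat_delete_def)
  have "Determinant.det (mat_delete A 0 0) = a ^ m"
    using m by (intro det_const_diag_upper dims upper_triangularI)
      (auto simp: del ind mod_Suc carrier_matD [OF dims] simp del: mat_delete_dim)
  moreover have "Determinant.det (mat_delete A m 0) = b ^ m"
    using m by (intro det_const_diag_lower dims) (auto simp: del ind mod_Suc)
  ultimately have cof: "cofactor A 0 0 = a ^ m" "cofactor A m 0 = (- 1) ^ m * b ^ m"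
    by (simp_all add: cofactor_def)
  have "Determinant.det A = (\<Sum>i<N. A $$ (i, 0) * cofactor A i 0)"
    by (rule laplace_expansion_column [OF A]) (use m in simp)
  also have "\<dots> = (\<Sum>i\<in>{0, m}. A $$ (i, 0) * cofactor A i 0)"
    using m by (intro sum.mono_neutral_right) (auto simp: ind mod_Suc split: if_splits)
  also have "\<dots> = a * a ^ m + b * ((- 1) ^ m * b ^ m)"
    using m by (simp add: cof ind)
  also have "\<dots> = a ^ N - (- b) ^ N"
    by (simp add: m power_minus [of b])
  finally show ?thesis by (simp add: A_def)
qed

lemma char_fun_eq:
  assumes "N \<ge> 2" and K: "K = complex_of_real (sync_gain \<kappa> \<tau> \<Omega>)"
  shows "char_fun N \<kappa> \<tau> \<Omega> \<mu> = (- \<mu> - K) ^ N - (- (K * exp (- \<mu> * complex_of_real \<tau>))) ^ N"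
proof -
  have "(- \<mu>) \<cdot>\<^sub>m 1\<^sub>m N - K \<cdot>\<^sub>m 1\<^sub>m N = (- \<mu> - K) \<cdot>\<^sub>m (1\<^sub>m N :: complex mat)"
    by (rule eq_matI) auto
  then show ?thesis
    using det_ring_matrix [OF assms(1)] by (simp add: char_fun_def Let_def K)
qed

text \<open>The N-th power gathers the branches
  \<open>\<mu> + K = c * K * exp (- \<mu> * \<tau>)\<close>, one for each c with
  \<open>c ^ N = 1\<close>, so moduli can be compared without choosing a root of unity.\<close>

lemma char_exponent_iff:
  assumes "N \<ge> 2" and K: "K = complex_of_real (sync_gain \<kappa> \<tau> \<Omega>)"
  shows "char_exponent N \<kappa> \<tau> \<Omega> \<mu> \<longleftrightarrow> (\<mu> + K) ^ N = (K * exp (- \<mu> * complex_of_real \<tau>)) ^ N"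
proof -
  have "- \<mu> - K = - (\<mu> + K)" by simp
  then have "char_fun N \<kappa> \<tau> \<Omega> \<mu>
      = (- 1) ^ N * ((\<mu> + K) ^ N - (K * exp (- \<mu> * complex_of_real \<tau>)) ^ N)"
    unfolding char_fun_eq [OF assms] right_diff_distrib by (simp only: power_minus [symmetric])
  then show ?thesis by (simp add: char_exponent_def)
qed

lemma cmod_char_exponent:
  assumes "N \<ge> 2" "char_exponent N \<kappa> \<tau> \<Omega> \<mu>"
  shows "cmod (\<mu> + complex_of_real (sync_gain \<kappa> \<tau> \<Omega>)) = \<bar>sync_gain \<kappa> \<tau> \<Omega>\<bar> * exp (- \<tau> * Re \<mu>)"
proof -
  let ?K = "complex_of_real (sync_gain \<kappa> \<tau> \<Omega>)"
  have "cmod (\<mu> + ?K) ^ N = cmod (?K * exp (- \<mu> * complex_of_real \<tau>)) ^ N"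
    using assms by (simp only: char_exponent_iff [OF assms(1) refl] norm_power [symmetric])
  then have "cmod (\<mu> + ?K) = cmod (?K * exp (- \<mu> * complex_of_real \<tau>))"
    using assms(1) by (auto dest: power_eq_imp_eq_base)
  then show ?thesis by (simp add: norm_mult mult.commute)
qed

text \<open>An exponent with Re \<mu> \<ge> 0 lies in the closed disc of radius -K about -K, since
  the exponential factor is at most 1. The rightmost point of that disc is -2K.\<close>

lemma Re_char_exponent_le:
  assumes "N \<ge> 2" "\<tau> > 0" "sync_gain \<kappa> \<tau> \<Omega> < 0" "char_exponent N \<kappa> \<tau> \<Omega> \<mu>"
  shows "Re \<mu> \<le> - 2 * sync_gain \<kappa> \<tau> \<Omega>"
proof (rule ccontr)
  define K where "K = sync_gain \<kappa> \<tau> \<Omega>"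
  assume "\<not> Re \<mu> \<le> - 2 * sync_gain \<kappa> \<tau> \<Omega>"
  then have Re: "Re \<mu> > - 2 * K" and "K < 0" using assms(3) by (simp_all add: K_def)
  have "exp (- \<tau> * Re \<mu>) \<le> 1" using Re \<open>K < 0\<close> assms(2) by simp
  then have "\<bar>K\<bar> * exp (- \<tau> * Re \<mu>) \<le> \<bar>K\<bar>" by (simp add: mult_left_le)
  moreover have "Re \<mu> + K \<le> cmod (\<mu> + complex_of_real K)"
    using complex_Re_le_cmod [of "\<mu> + complex_of_real K"] by simp
  ultimately show False
    using cmod_char_exponent [OF assms(1,4)] Re \<open>K < 0\<close> unfolding K_def by linarith
qed

text \<open>For K > 0 the closed disc of radius K about -K touches the closed right half-plane only
  at 0.\<close>

lemma Re_char_exponent_neg: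
  assumes "N \<ge> 2" "\<tau> > 0" "sync_gain \<kappa> \<tau> \<Omega> > 0" "char_exponent N \<kappa> \<tau> \<Omega> \<mu>" "\<mu> \<noteq> 0"
  shows "Re \<mu> < 0"
proof (rule ccontr)
  define K where "K = sync_gain \<kappa> \<tau> \<Omega>"
  assume "\<not> Re \<mu> < 0"
  then have Re: "Re \<mu> \<ge> 0" and "K > 0" using assms(3) by (simp_all add: K_def)
  have "exp (- \<tau> * Re \<mu>) \<le> 1" using Re assms(2) by simp
  then have "\<bar>K\<bar> * exp (- \<tau> * Re \<mu>) \<le> K" using \<open>K > 0\<close> by (simp add: mult_left_le)
  then have le: "cmod (\<mu> + complex_of_real K) \<le> K"
    using cmod_char_exponent [OF assms(1,4)] by (simp add: K_def)
  then have "Re \<mu> = 0"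
    using complex_Re_le_cmod [of "\<mu> + complex_of_real K"] Re by simp
  moreover have "(Re \<mu> + K)\<^sup>2 + (Im \<mu>)\<^sup>2 \<le> K\<^sup>2"
    using power_mono [OF le, of 2] by (simp add: cmod_power2)
  ultimately have "\<mu> = 0" by (simp add: complex_eq_iff)
  with assms(5) show False ..
qed

lemma zorder_char_fun_eq_1:
  assumes "N \<ge> 2" "\<tau> > 0" "sync_gain \<kappa> \<tau> \<Omega> > 0"
  shows "zorder (char_fun N \<kappa> \<tau> \<Omega>) 0 = 1"
proof -
  define K where "K = complex_of_real (sync_gain \<kappa> \<tau> \<Omega>)"
  have eq: "char_fun N \<kappa> \<tau> \<Omega>
      = (\<lambda>\<mu>. (- \<mu> - K) ^ N - (- (K * exp (- \<mu> * complex_of_real \<tau>))) ^ N)"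
    by (rule ext) (simp add: char_fun_eq [OF assms(1) K_def])
  have "(char_fun N \<kappa> \<tau> \<Omega> has_field_derivative
      - (of_nat N * (- K) ^ (N - 1) * (1 + K * complex_of_real \<tau>))) (at 0)"
    unfolding eq by (auto intro!: derivative_eq_intros simp: algebra_simps)
  then have deriv: "deriv (char_fun N \<kappa> \<tau> \<Omega>) 0
      = - (of_nat N * (- K) ^ (N - 1) * (1 + K * complex_of_real \<tau>))"
    by (rule DERIV_imp_deriv)
  \<comment> \<open>The derivative at 0 can vanish only if K = 0 or K \<tau> = -1, and K > 0
    excludes both.\<close>
  have "Re (1 + K * complex_of_real \<tau>) > 0"
    using assms(2,3) by (simp add: K_def add_pos_pos)
  then have "1 + K * complex_of_real \<tau> \<noteq> 0" by force
  then have "deriv (char_fun N \<kappa> \<tau> \<Omega>) 0 \<noteq> 0"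
    using assms(1,3) by (simp add: deriv K_def)
  moreover have "char_fun N \<kappa> \<tau> \<Omega> holomorphic_on UNIV"
    unfolding eq by (intro holomorphic_intros)
  moreover have "char_fun N \<kappa> \<tau> \<Omega> 0 = 0" by (simp add: eq)
  ultimately show ?thesis
    by (intro zorder_zero_eqI [of _ UNIV]) auto
qed

text \<open>The delayed term carries the factor K, so only \<open>(- \<mu>) ^ N\<close> remains when
  K = 0.\<close>

lemma zorder_char_fun_eq_N:
  assumes "N \<ge> 2" "sync_gain \<kappa> \<tau> \<Omega> = 0"
  shows "zorder (char_fun N \<kappa> \<tau> \<Omega>) 0 = int N"
proof (rule zorder_eqI [of UNIV])
  show "char_fun N \<kappa> \<tau> \<Omega> w = (- 1) ^ N * (w - 0) powi int N" for w
    using assms by (simp add: char_fun_eq [OF assms(1) refl] power_minus [of w])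
qed auto

lemma ex_char_exponent_Re_nonneg:
  assumes "N \<ge> 2" "\<tau> > 0" "sync_gain \<kappa> \<tau> \<Omega> < 0"
  obtains \<mu> where "char_exponent N \<kappa> \<tau> \<Omega> \<mu>" "\<mu> \<noteq> 0" "Re \<mu> \<ge> 0"
proof -
  define k where "k = - sync_gain \<kappa> \<tau> \<Omega>"
  \<comment> \<open>Any N-th root of unity other than 1 would do; the branch c = 1 is the one
    containing the trivial exponent 0.\<close>
  define c where "c = cis (2 * pi / N)"
  define \<phi> where "\<phi> \<mu> = of_real k - of_real k * c * exp (- \<mu> * of_real \<tau>)" for \<mu> :: complex
  have "k > 0" using assms(3) by (simp add: k_def)
  have c_exp: "c = exp (2 * of_real pi * \<i> * of_nat 1 / of_nat N)"
    by (simp add: c_def cis_conv_exp mult_ac)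
  have cN: "c ^ N = 1"
    using complex_root_unity [of N 1] assms(1) by (simp only: c_exp)
  have "c \<noteq> 1"
    using complex_root_unity_eq_1 [of N 1] assms(1) by (simp add: c_exp)
  have Re_nonneg: "Re \<mu> \<ge> 0" if "\<mu> \<in> cball (of_real k) k" for \<mu>
    using that complex_Re_le_cmod [of "of_real k - \<mu>"] by (simp add: dist_norm)
  \<comment> \<open>As c has modulus 1, \<open>\<phi> \<mu>\<close> has distance
    \<open>k * exp (- \<tau> * Re \<mu>)\<close> from k, which is at most k when Re \<mu> \<ge>
    0.\<close>
  have "\<phi> \<in> cball (of_real k) k \<rightarrow> cball (of_real k) k"
  proof
    fix \<mu> :: complex assume "\<mu> \<in> cball (of_real k) k"
    then have "exp (- (Re \<mu> * \<tau>)) \<le> 1" using Re_nonneg assms(2) by simp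
    then show "\<phi> \<mu> \<in> cball (of_real k) k"
      using \<open>k > 0\<close> by (simp add: \<phi>_def dist_norm norm_mult c_def mult_left_le)
  qed
  moreover have "continuous_on (cball (of_real k) k) \<phi>"
    unfolding \<phi>_def by (intro continuous_intros)
  ultimately obtain \<mu> where \<mu>: "\<mu> \<in> cball (of_real k) k" "\<phi> \<mu> = \<mu>"
    using brouwer_ball [OF \<open>k > 0\<close>] by metis
  \<comment> \<open>Here \<open>\<phi> 0 = k * (1 - c)\<close> is nonzero, so 0 is not a fixed
    point.\<close>
  have "\<mu> \<noteq> 0" using \<mu>(2) \<open>c \<noteq> 1\<close> \<open>k > 0\<close> by (auto simp: \<phi>_def)
  \<comment> \<open>With K = -k the fixed point equation is the branch of c, and raising it to the
    N-th power removes c.\<close>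
  have "\<mu> + of_real (sync_gain \<kappa> \<tau> \<Omega>)
      = c * (of_real (sync_gain \<kappa> \<tau> \<Omega>) * exp (- \<mu> * of_real \<tau>))"
    using \<mu>(2) by (simp add: \<phi>_def k_def algebra_simps)
  then have "char_exponent N \<kappa> \<tau> \<Omega> \<mu>"
    unfolding char_exponent_iff [OF assms(1) refl] by (simp only: power_mult_distrib [of c] cN mult_1)
  with \<open>\<mu> \<noteq> 0\<close> Re_nonneg [OF \<mu>(1)] that show thesis by blast
qed

theorem lemma1:
  fixes N :: nat and \<omega> \<kappa> \<tau> \<Omega> :: real
  assumes "N \<ge> 2" and "\<kappa> > 0" and "\<tau> > 0"
    and "ring_solution N \<omega> \<kappa> \<tau> (sync \<Omega>)"
  shows "(linearly_stable N \<kappa> \<tau> \<Omega> \<longleftrightarrow> cos (\<Omega> * \<tau>) > 0) \<and>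
    (cos (\<Omega> * \<tau>) < 0 \<longrightarrow>
      (\<forall>\<mu>. char_exponent N \<kappa> \<tau> \<Omega> \<mu> \<longrightarrow> Re \<mu> \<le> - 2 * \<kappa> * cos (\<Omega> * \<tau>)))"
proof (intro conjI impI allI)
  have gain: "sync_gain \<kappa> \<tau> \<Omega> > 0 \<longleftrightarrow> cos (\<Omega> * \<tau>) > 0" "sync_gain \<kappa> \<tau> \<Omega> < 0 \<longleftrightarrow> cos (\<Omega> * \<tau>) < 0"
    using assms(2) by (simp_all add: sync_gain_def zero_less_mult_iff mult_less_0_iff)
  show "linearly_stable N \<kappa> \<tau> \<Omega> \<longleftrightarrow> cos (\<Omega> * \<tau>) > 0"
  proof
    assume stable: "linearly_stable N \<kappa> \<tau> \<Omega>"
    show "cos (\<Omega> * \<tau>) > 0"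
    proof (rule ccontr)
      assume "\<not> cos (\<Omega> * \<tau>) > 0"
      then consider "sync_gain \<kappa> \<tau> \<Omega> = 0" | "sync_gain \<kappa> \<tau> \<Omega> < 0"
        using gain by linarith
      then show False
      proof cases
        case 1
        then show ?thesis
          using stable assms(1) zorder_char_fun_eq_N [OF assms(1) 1] by (simp add: linearly_stable_def)
      next
        case 2
        then show ?thesis
          using stable ex_char_exponent_Re_nonneg [OF assms(1,3) 2]
          by (metis linearly_stable_def not_less)
      qed
    qed
  next
    assume "cos (\<Omega> * \<tau>) > 0"
    then have "sync_gain \<kappa> \<tau> \<Omega> > 0" using gain by simp
    moreover have "char_exponent N \<kappa> \<tau> \<Omega> 0"
      by (simp add: char_exponent_iff [OF assms(1) refl])
    ultimately show "linearly_stable N \<kappa> \<tau> \<Omega>"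
      using assms(1,3) Re_char_exponent_neg zorder_char_fun_eq_1
      by (auto simp: linearly_stable_def)
  qed
  show "Re \<mu> \<le> - 2 * \<kappa> * cos (\<Omega> * \<tau>)"
    if "cos (\<Omega> * \<tau>) < 0" "char_exponent N \<kappa> \<tau> \<Omega> \<mu>" for \<mu>
    using that gain Re_char_exponent_le [OF assms(1,3) _ that(2)] by (simp add: sync_gain_def mult.assoc)
qed

end
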